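(* Let $N\ge2$ and $0<\rho<\frac{\pi}{2N}$. Let $\tau_i=\frac{(2i-1)\pi}{2N}$ and $s_i=[\cos(\tau_i+\rho),\cos(\tau_i-\rho)]$, $i=1,\ldots,N$, and let $\omega_{1/2,-1/2}(x)=\left(\frac{1-x}{1+x}\right)^{1/2}$ be the Chebyshev weight of the fourth kind. Define the polynomials $$\widehat Q_0(x)=1,\qquad \widehat Q_1(x)=\frac{T_N(x)-T_1(x)}{1-x}-\lambda_1,\qquad \widehat Q_k(x)=\frac{T_N(x)-T_k(x)}{1-x},\quad k=2,\ldots,N-1,$$ with $$\lambda_1=\frac{\sin^2(\rho)}{2\rho^2+\sin^2(\rho)},$$ and let $\hat M_N\in\mathbb R^{N\times N}$ be given by $[\hat M_N]_{i,k+1}=\int_{s_i}\widehat Q_k(x)\,\omega_{1/2,-1/2}(x)\,dx$, $i=1,\ldots,N$, $k=0,\ldots,N-1$. Then $$\hat M_N^\top\hat M_N=\operatorname{diag}(d_0,\ldots,d_{N-1}),$$ where $$d_0=2N\left[2\rho^2+\sin^2(\rho)\right],\qquad d_1=\frac{4N\rho^2\sin^2(\rho)}{2\rho^2+\sin^2(\rho)},\qquad d_k=\frac N2\left[\frac{2\sin(k\rho)}{k}\right]^2,\quad k=2,\ldots,N-1.$$ In particular, $\hat M_N$ is nonsingular.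
   Context: $T_k$ is the Chebyshev polynomial of the first kind of degree $k$, $T_k(\cos\theta)=\cos(k\theta)$. Since $T_N(1)=T_k(1)=1$, the quotients $(T_N(x)-T_k(x))/(1-x)$ are polynomials. *)

theory Defs
  imports "HOL-Analysis.Analysis" "Jordan_Normal_Form.Determinant"
begin

definition cheb_T :: "nat \<Rightarrow> real poly" where
  "cheb_T k = (THE p. \<forall>\<theta>. poly p (cos \<theta>) = cos (real k * \<theta>))"

lemma cheb_T_exists:
  "\<exists>p :: real poly. degree p = k \<and> lead_coeff p > 0 \<and> (\<forall>\<theta>. poly p (cos \<theta>) = cos (real k * \<theta>))"
proof (induction k rule: less_induct)
  case (less k)
  consider "k = 0" | "k = 1" | j where "k = Suc (Suc j)"
    by (metis One_nat_def not0_implies_Suc)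
  then show ?case
  proof cases
    case 1
    then show ?thesis by (intro exI[of _ 1]) auto
  next
    case 2
    then show ?thesis by (intro exI[of _ "[:0, 1:]"]) auto
  next
    case (3 j)
    obtain p :: "real poly" where p: "degree p = j" "\<And>\<theta>. poly p (cos \<theta>) = cos (real j * \<theta>)"
      using less[of j] 3 by auto
    obtain q :: "real poly" where q: "degree q = Suc j" "lead_coeff q > 0"
      "\<And>\<theta>. poly q (cos \<theta>) = cos (real (Suc j) * \<theta>)"
      using less[of "Suc j"] 3 by auto
    define r where "r = [:0, 2:] * q"
    have q0: "q \<noteq> 0" using q(1) by auto
    have dr: "degree r = Suc (Suc j)" and lr: "lead_coeff r = 2 * lead_coeff q"
      unfolding r_def lead_coeff_mult using q q0 by (auto simp: degree_mult_eq)
    have lt: "degree (- p) < degree r" using p dr by simp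
    have d: "degree (- p + r) = degree r" by (rule degree_add_eq_right[OF lt])
    have l: "lead_coeff (- p + r) = lead_coeff r" by (rule lead_coeff_add_le[OF lt])
    have e: "poly (- p + r) (cos \<theta>) = cos (real k * \<theta>)" for \<theta>
    proof -
      have "cos (real k * \<theta>) + cos (real j * \<theta>) = 2 * cos \<theta> * cos (real (Suc j) * \<theta>)"
        using cos_add[of "real (Suc j) * \<theta>" \<theta>] cos_diff[of "real (Suc j) * \<theta>" \<theta>] 3
        by (simp add: algebra_simps)
      then show ?thesis by (simp add: r_def p q)
    qed
    show ?thesis using d l dr lr q(2) e 3 by (intro exI[of _ "- p + r"]) auto
  qed
qed

lemma cheb_T_unique:
  fixes p q :: "real poly"
  assumes "\<forall>\<theta>. poly p (cos \<theta>) = cos (real k * \<theta>)" "\<forall>\<theta>. poly q (cos \<theta>) = cos (real k * \<theta>)"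
  shows "p = q"
proof (rule ccontr)
  assume "p \<noteq> q"
  then have "finite {x. poly (p - q) x = 0}" by (intro poly_roots_finite) simp
  moreover have "{-1..1} \<subseteq> {x. poly (p - q) x = 0}"
  proof
    fix x :: real assume "x \<in> {-1..1}"
    then have "x = cos (arccos x)" by simp
    then show "x \<in> {x. poly (p - q) x = 0}"
      using assms[rule_format, of "arccos x"] by simp
  qed
  ultimately have "finite {-1..1 :: real}" by (rule rev_finite_subset)
  then show False by (simp add: infinite_Icc)
qed

lemma cheb_T_props: "degree (cheb_T k) = k \<and> (\<forall>\<theta>. poly (cheb_T k) (cos \<theta>) = cos (real k * \<theta>))"
proof -
  obtain p :: "real poly" where p: "degree p = k" "\<forall>\<theta>. poly p (cos \<theta>) = cos (real k * \<theta>)"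
    using cheb_T_exists by blast
  have "cheb_T k = p"
    unfolding cheb_T_def using p(2) cheb_T_unique by (intro the_equality) blast+
  with p show ?thesis by simp
qed

lemma degree_cheb_T: "degree (cheb_T k) = k"
  using cheb_T_props by blast

lemma poly_cheb_T_cos: "poly (cheb_T k) (cos \<theta>) = cos (real k * \<theta>)"
  using cheb_T_props by blast

lemma cheb_T_diff_dvd: "[:1, -1:] dvd cheb_T N - cheb_T k"
proof -
  have "poly (cheb_T N - cheb_T k) 1 = 0"
    using poly_cheb_T_cos[of N 0] poly_cheb_T_cos[of k 0] by simp
  then have "[:- 1, 1:] dvd cheb_T N - cheb_T k" by (simp only: poly_eq_0_iff_dvd)
  moreover have "[:1, -1:] = - [:- 1, 1 :: real:]" by simp
  ultimately show ?thesis by (simp only: minus_dvd_iff)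
qed

text \<open>Division of polynomials; it is exact by \<open>cheb_T_diff_dvd\<close>.\<close>
definition cheb_quot :: "nat \<Rightarrow> nat \<Rightarrow> real poly" where
  "cheb_quot N k = (cheb_T N - cheb_T k) div [:1, -1:]"

definition weight4 :: "real \<Rightarrow> real" where
  "weight4 x = ((1 - x) / (1 + x)) powr (1 / 2)"

definition tau :: "nat \<Rightarrow> nat \<Rightarrow> real" where
  "tau N i = (2 * real i - 1) * pi / (2 * real N)"

definition seg :: "nat \<Rightarrow> real \<Rightarrow> nat \<Rightarrow> real set" where
  "seg N \<rho> i = {cos (tau N i + \<rho>) .. cos (tau N i - \<rho>)}"

definition lambda1 :: "real \<Rightarrow> real" where
  "lambda1 \<rho> = (sin \<rho>)\<^sup>2 / (2 * \<rho>\<^sup>2 + (sin \<rho>)\<^sup>2)"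

definition Qhat :: "nat \<Rightarrow> real \<Rightarrow> nat \<Rightarrow> real poly" where
  "Qhat N \<rho> k =
     (if k = 0 then 1
      else if k = 1 then cheb_quot N 1 - [:lambda1 \<rho>:]
      else cheb_quot N k)"

text \<open>Matrix entries are indexed from 0, so row \<open>i\<close> belongs to the segment with number \<open>Suc i\<close>.\<close>
definition Mhat :: "nat \<Rightarrow> real \<Rightarrow> real mat" where
  "Mhat N \<rho> =
     Matrix.mat N N (\<lambda>(i, k). integral (seg N \<rho> (Suc i)) (\<lambda>x. poly (Qhat N \<rho> k) x * weight4 x))"

end

theory Submission
  imports Defs
begin

text \<open>
  The substitution \<open>x = cos \<theta>\<close> turns the segment \<open>seg N \<rho> i\<close> into the interval of radius \<open>\<rho>\<close>
  around \<open>tau N i\<close> and the measure \<open>weight4 x dx\<close> into \<open>(1 - cos \<theta>) d\<theta>\<close>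
  (\<open>has_integral_weight4_cos\<close>). The factor \<open>1 - cos \<theta>\<close> cancels the denominator of the quotients
  \<open>cheb_quot N k\<close>, so that a matrix entry is the integral of \<open>1 - cos \<theta>\<close> or of
  \<open>cos (N \<theta>) - cos (k \<theta>)\<close>. The points \<open>tau N i\<close> are the zeros of \<open>cos (N \<theta>)\<close>, and \<open>cos (N \<theta>)\<close> is
  odd about each of them, so its integral vanishes. Consequently column \<open>k\<close> samples, at the points
  \<open>tau N i\<close>, a constant plus a multiple of \<open>cos (k \<theta>)\<close> (of \<open>cos \<theta>\<close> if \<open>k = 0\<close>); see \<open>Mhat_entry\<close>.

  The sampled cosines and the constant are orthogonal (\<open>sum_cos_mult_cos_tau\<close>), which is the
  orthogonality of the discrete cosine transform. Only the columns 0 and 1 share a frequency.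
  Before the shift by \<open>lambda1 \<rho>\<close> they are \<open>2 \<rho> - v\<close> and \<open>- v\<close>, where \<open>v\<close> samples
  \<open>2 sin \<rho> cos \<theta>\<close> and is orthogonal to the constants, and subtracting \<open>lambda1 \<rho>\<close> times column 0 is exactly the
  Gram-Schmidt step that makes them orthogonal. All diagonal entries of the Gram matrix are positive,
  because \<open>0 < k \<rho> < pi\<close> for \<open>0 < k < N\<close>, and this gives nonsingularity.
\<close>

section \<open>Orthogonality of sampled cosines\<close>

text \<open>
  Multiplied by \<open>2 sin h\<close> with \<open>h = m pi / (2 N)\<close>, the sum telescopes to \<open>sin (2 N h) = sin (m pi)\<close>.
  The bounds on \<open>m\<close> ensure that the multiplier is not zero.
\<close>
lemma sum_cos_tau_eq_0:
  assumes "0 < m" and "m < 2 * N"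
  shows "(\<Sum>i<N. cos (real m * tau N (Suc i))) = 0"
proof -
  define h where "h = real m * (pi / (2 * real N))"
  have N: "real N > 0" using assms by simp
  have "0 < h" using assms by (simp add: h_def)
  moreover have "h < pi"
  proof -
    have "real m < 2 * real N" using assms(2) by linarith
    then have "real m * pi < 2 * real N * pi" by simp
    then show ?thesis using N by (simp add: h_def field_simps)
  qed
  ultimately have nz: "sin h \<noteq> 0" using sin_gt_zero[of h] by simp
  have "2 * sin h * (\<Sum>i<N. cos (real m * tau N (Suc i)))
      = (\<Sum>i<N. sin (real (Suc i) * (2 * h)) - sin (real i * (2 * h)))"
    unfolding sum_distrib_left
  proof (rule sum.cong[OF refl])
    fix i
    have t: "real m * tau N (Suc i) = real i * (2 * h) + h"
      using N by (simp add: h_def tau_def field_simps)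
    have s: "real (Suc i) * (2 * h) = (real i * (2 * h) + h) + h"
      by (simp add: algebra_simps)
    have r: "real i * (2 * h) = (real i * (2 * h) + h) - h"
      by simp
    have "sin (x + h) - sin (x - h) = 2 * sin h * cos x" for x
      by (simp add: sin_add sin_diff)
    then show "2 * sin h * cos (real m * tau N (Suc i))
        = sin (real (Suc i) * (2 * h)) - sin (real i * (2 * h))"
      unfolding t s by (metis r)
  qed
  also have "\<dots> = sin (real N * (2 * h))"
    by (subst sum_lessThan_telescope) simp
  also have "real N * (2 * h) = real m * pi"
    using N by (simp add: h_def)
  finally show ?thesis using nz by simp
qed

lemma sum_cos_mult_cos_tau:
  assumes "0 < j" "j < N" "0 < k" "k < N"
  shows "(\<Sum>i<N. cos (real j * tau N (Suc i)) * cos (real k * tau N (Suc i)))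
       = (if j = k then real N / 2 else 0)"
proof -
  have dif: "(\<Sum>i<N. cos (real (m - n) * tau N (Suc i)) + cos (real (m + n) * tau N (Suc i)))
      = (if m = n then real N else 0)"
    if "n \<le> m" "0 < n" "m < N" for m n
    using that sum_cos_tau_eq_0[of "m - n" N] sum_cos_tau_eq_0[of "m + n" N]
    by (auto simp: sum.distrib simp del: of_nat_add of_nat_diff)
  have prod: "cos (real m * t) * cos (real n * t) = (cos (real (m - n) * t) + cos (real (m + n) * t)) / 2"
    if "n \<le> m" for m n t
    using that cos_times_cos[of "real m * t" "real n * t"] by (simp add: algebra_simps of_nat_diff)
  have main: "(\<Sum>i<N. cos (real m * tau N (Suc i)) * cos (real n * tau N (Suc i)))
      = (if m = n then real N / 2 else 0)"
    if "n \<le> m" "0 < n" "m < N" for m n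
    using dif[OF that] by (simp add: prod[OF that(1)] sum_divide_distrib[symmetric])
  show ?thesis
  proof (cases "k \<le> j")
    case True
    then show ?thesis using main assms by auto
  next
    case False
    then show ?thesis using main[of j k] assms by (simp add: mult.commute)
  qed
qed

text \<open>
  The Gram product of two samples of the form constant plus cosine, which is the form of every
  column of \<open>Mhat N \<rho>\<close>.
\<close>
lemma sum_affine_cos_tau:
  fixes a b c d :: real
  assumes "0 < j" "j < N" "0 < k" "k < N"
  shows "(\<Sum>i<N. (a + b * cos (real j * tau N (Suc i))) * (c + d * cos (real k * tau N (Suc i))))
       = real N * a * c + (if j = k then real N / 2 * b * d else 0)"
proof -
  let ?C = "\<lambda>j i. cos (real j * tau N (Suc i))"
  have "(\<Sum>i<N. (a + b * ?C j i) * (c + d * ?C k i))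
      = (\<Sum>i<N. a * c + a * d * ?C k i + b * c * ?C j i + b * d * (?C j i * ?C k i))"
    by (rule sum.cong) (auto simp: algebra_simps)
  also have "\<dots> = real N * a * c + a * d * (\<Sum>i<N. ?C k i) + b * c * (\<Sum>i<N. ?C j i)
      + b * d * (\<Sum>i<N. ?C j i * ?C k i)"
    by (simp add: sum.distrib sum_distrib_left)
  also have "\<dots> = real N * a * c + (if j = k then real N / 2 * b * d else 0)"
    using assms sum_cos_mult_cos_tau[OF assms] by (simp add: sum_cos_tau_eq_0)
  finally show ?thesis .
qed

section \<open>Integrals over the segments\<close>

lemma weight4_eq:
  assumes "-1 < x" "x < 1"
  shows "weight4 x = (1 - x) / sqrt (1 - x\<^sup>2)"
proof -
  have "1 - x\<^sup>2 = (1 - x) * (1 + x)" by (simp add: power2_eq_square algebra_simps)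
  moreover have "sqrt (1 - x) = (1 - x) / sqrt (1 - x)" using assms by (simp add: real_div_sqrt)
  ultimately show ?thesis
    using assms
    by (simp add: weight4_def powr_half_sqrt real_sqrt_divide real_sqrt_mult flip: divide_divide_eq_left)
qed

text \<open>
  The substitution \<open>x = cos \<theta>\<close>. Given an antiderivative \<open>F\<close> in the variable \<open>\<theta>\<close>, it is the
  fundamental theorem of calculus for \<open>- F (arccos x)\<close>.
\<close>
lemma has_integral_weight4_cos:
  fixes F f :: "real \<Rightarrow> real"
  assumes "0 < a" "a \<le> b" "b < pi"
    and F: "\<And>t. 0 < t \<Longrightarrow> t < pi \<Longrightarrow> (F has_real_derivative f (cos t) * (1 - cos t)) (at t)"
  shows "((\<lambda>x. f x * weight4 x) has_integral (F b - F a)) {cos b..cos a}"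
proof -
  have ends: "-1 < cos b" "cos a < 1" "cos b \<le> cos a"
    using assms cos_monotone_0_pi[of b pi] cos_monotone_0_pi[of 0 a]
      cos_monotone_0_pi_le[of a b] by auto
  have "((\<lambda>x. - F (arccos x)) has_vector_derivative f x * weight4 x) (at x within {cos b..cos a})"
    if "x \<in> {cos b..cos a}" for x
  proof -
    have x: "-1 < x" "x < 1" using that ends by auto
    have "(F has_real_derivative f x * (1 - x)) (at (arccos x))"
      using F[of "arccos x"] arccos_lt_bounded[OF x] x by simp
    from DERIV_chain2[OF this DERIV_arccos[OF x]]
    have "((\<lambda>x. - F (arccos x)) has_real_derivative
        - (f x * (1 - x) * inverse (- sqrt (1 - x\<^sup>2)))) (at x)"
      by (rule DERIV_minus)
    also have "- (f x * (1 - x) * inverse (- sqrt (1 - x\<^sup>2))) = f x * weight4 x"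
      by (simp add: weight4_eq[OF x] divide_inverse)
    finally show ?thesis
      by (simp add: has_real_derivative_iff_has_vector_derivative
          has_vector_derivative_at_within)
  qed
  from fundamental_theorem_of_calculus[OF ends(3) this]
  show ?thesis using assms by (simp add: arccos_cos)
qed

lemma poly_cheb_quot_cos:
  "poly (cheb_quot N k) (cos t) * (1 - cos t) = cos (real N * t) - cos (real k * t)"
proof -
  have "cheb_quot N k * [:1, -1:] = cheb_T N - cheb_T k"
    unfolding cheb_quot_def using cheb_T_diff_dvd by (rule dvd_div_mult_self)
  then have "poly (cheb_quot N k * [:1, -1:]) (cos t) = poly (cheb_T N - cheb_T k) (cos t)"
    by simp
  then show ?thesis by (simp add: poly_cheb_T_cos algebra_simps)
qed

lemma tau_interval_bounds:
  assumes "i < N" "0 < \<rho>" "\<rho> < pi / (2 * real N)"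
  shows "0 < tau N (Suc i) - \<rho>" "tau N (Suc i) + \<rho> < pi"
proof -
  define h where "h = pi / (2 * real N)"
  have t: "tau N (Suc i) = (2 * real i + 1) * h"
    by (simp add: tau_def h_def)
  have p: "pi = 2 * real N * h" and h: "0 < h"
    using assms(1) by (simp_all add: h_def)
  have "real i + 1 \<le> real N" using assms(1) by linarith
  then have "(2 * real i + 2) * h \<le> 2 * real N * h" using h by (intro mult_right_mono) auto
  moreover have "0 \<le> real i * h" using h by simp
  ultimately show "0 < tau N (Suc i) - \<rho>" "tau N (Suc i) + \<rho> < pi"
    using assms(3)[folded h_def] unfolding t p[symmetric] by (auto simp: algebra_simps)
qed

lemma has_integral_seg:
  assumes "i < N" "0 < \<rho>" "\<rho> < pi / (2 * real N)"
    and "\<And>t. (F has_real_derivative f (cos t) * (1 - cos t)) (at t)"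
  shows "((\<lambda>x. f x * weight4 x) has_integral (F (tau N (Suc i) + \<rho>) - F (tau N (Suc i) - \<rho>)))
    (seg N \<rho> (Suc i))"
  unfolding seg_def
  using tau_interval_bounds[OF assms(1-3)] assms(2,4)
  by (intro has_integral_weight4_cos) auto

lemma has_integral_seg_1:
  assumes "i < N" "0 < \<rho>" "\<rho> < pi / (2 * real N)"
  shows "(weight4 has_integral (2 * \<rho> - 2 * sin \<rho> * cos (tau N (Suc i)))) (seg N \<rho> (Suc i))"
proof -
  have "((\<lambda>t. t - sin t) has_real_derivative 1 * (1 - cos t)) (at t)" for t
    by (auto intro!: derivative_eq_intros)
  from has_integral_seg[where f = "\<lambda>_. 1", OF assms this]
  show ?thesis by (simp add: sin_add sin_diff algebra_simps)
qed

text \<open>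
  The term \<open>cos (N \<theta>)\<close> contributes a multiple of \<open>cos (N tau)\<close>, which is zero at the nodes.
\<close>
lemma has_integral_seg_cheb_quot:
  assumes "i < N" "0 < \<rho>" "\<rho> < pi / (2 * real N)" "0 < k"
  shows "((\<lambda>x. poly (cheb_quot N k) x * weight4 x) has_integral
    (- (2 * sin (real k * \<rho>) / real k) * cos (real k * tau N (Suc i)))) (seg N \<rho> (Suc i))"
proof -
  let ?t = "tau N (Suc i)"
  let ?F = "\<lambda>n t. sin (real n * t) / real n"
  have F: "(?F n has_real_derivative cos (real n * t)) (at t)" if "0 < n" for n t
    using that by (auto intro!: derivative_eq_intros)
  have N: "0 < N" using assms by simp
  have "((\<lambda>t. ?F N t - ?F k t) has_real_derivative
      poly (cheb_quot N k) (cos t) * (1 - cos t)) (at t)" for t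
    unfolding poly_cheb_quot_cos using F N assms by (intro DERIV_diff) auto
  note I = has_integral_seg[where f = "poly (cheb_quot N k)", OF assms(1-3) this]
  have inc: "?F n (t + \<rho>) - ?F n (t - \<rho>) = 2 * sin (real n * \<rho>) / real n * cos (real n * t)" for n t
    by (simp add: distrib_left right_diff_distrib sin_add sin_diff diff_divide_distrib[symmetric])
  have "real N * ?t = real i * pi + pi / 2"
    using N by (simp add: tau_def field_simps)
  then have "cos (real N * ?t) = 0" by (simp add: cos_add)
  then have "?F N (?t + \<rho>) - ?F N (?t - \<rho>) = 0" by (simp only: inc mult_zero_right)
  then have "?F N (?t + \<rho>) - ?F k (?t + \<rho>) - (?F N (?t - \<rho>) - ?F k (?t - \<rho>))
      = - (2 * sin (real k * \<rho>) / real k) * cos (real k * ?t)"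
    using inc[of k ?t] unfolding minus_mult_left[symmetric] by linarith
  with I show ?thesis by simp
qed

section \<open>The Gram matrix\<close>

definition col_mean :: "real \<Rightarrow> nat \<Rightarrow> real" where
  "col_mean \<rho> k = (if k = 0 then 2 * \<rho> else if k = 1 then - 2 * \<rho> * lambda1 \<rho> else 0)"

definition col_amplitude :: "real \<Rightarrow> nat \<Rightarrow> real" where
  "col_amplitude \<rho> k =
     (if k = 0 then - 2 * sin \<rho>
      else if k = 1 then - 2 * sin \<rho> * (1 - lambda1 \<rho>)
      else - (2 * sin (real k * \<rho>) / real k))"

text \<open>
  The frequency of column \<open>k\<close> is \<open>max 1 k\<close>, since column 0 gets its \<open>cos \<theta>\<close> from the
  transformed weight \<open>1 - cos \<theta>\<close>.
\<close>
lemma Mhat_entry: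
  assumes "i < N" "k < N" "0 < \<rho>" "\<rho> < pi / (2 * real N)"
  shows "Mhat N \<rho> $$ (i, k)
       = col_mean \<rho> k + col_amplitude \<rho> k * cos (real (max 1 k) * tau N (Suc i))"
proof -
  have "((\<lambda>x. poly (Qhat N \<rho> k) x * weight4 x) has_integral
      (col_mean \<rho> k + col_amplitude \<rho> k * cos (real (max 1 k) * tau N (Suc i))))
      (seg N \<rho> (Suc i))"
  proof -
    note I0 = has_integral_seg_1[OF assms(1,3,4)]
    note I = has_integral_seg_cheb_quot[OF assms(1,3,4), of k]
    consider "k = 0" | "k = 1" | "k \<ge> 2" by linarith
    then show ?thesis
    proof cases
      case 1
      then show ?thesis using I0 by (simp add: Qhat_def col_mean_def col_amplitude_def)
    next
      case 2
      with I have "((\<lambda>x. poly (cheb_quot N 1) x * weight4 x) has_integral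
          (- 2 * sin \<rho> * cos (tau N (Suc i)))) (seg N \<rho> (Suc i))"
        by simp
      from has_integral_diff[OF this has_integral_mult_right[OF I0, of "lambda1 \<rho>"]]
      show ?thesis using 2 by (simp add: Qhat_def col_mean_def col_amplitude_def algebra_simps)
    next
      case 3
      then show ?thesis using I by (simp add: Qhat_def col_mean_def col_amplitude_def max_def)
    qed
  qed
  then show ?thesis using assms by (simp add: Mhat_def integral_unique)
qed

lemma Mhat_gram_entry:
  assumes "2 \<le> N" "j < N" "k < N" "0 < \<rho>" "\<rho> < pi / (2 * real N)"
  shows "(transpose_mat (Mhat N \<rho>) * Mhat N \<rho>) $$ (j, k)
       = real N * col_mean \<rho> j * col_mean \<rho> k
         + (if max 1 j = max 1 k then real N / 2 * col_amplitude \<rho> j * col_amplitude \<rho> k else 0)"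
proof -
  have dim: "Mhat N \<rho> \<in> carrier_mat N N" by (simp add: Mhat_def)
  have "(transpose_mat (Mhat N \<rho>) * Mhat N \<rho>) $$ (j, k)
      = (\<Sum>i<N. Mhat N \<rho> $$ (i, j) * Mhat N \<rho> $$ (i, k))"
    using dim assms by (auto simp: scalar_prod_def atLeast0LessThan intro!: sum.cong)
  also have "\<dots> = (\<Sum>i<N. (col_mean \<rho> j + col_amplitude \<rho> j * cos (real (max 1 j) * tau N (Suc i)))
      * (col_mean \<rho> k + col_amplitude \<rho> k * cos (real (max 1 k) * tau N (Suc i))))"
    using assms by (intro sum.cong refl) (simp add: Mhat_entry)
  also have "\<dots> = real N * col_mean \<rho> j * col_mean \<rho> k
      + (if max 1 j = max 1 k then real N / 2 * col_amplitude \<rho> j * col_amplitude \<rho> k else 0)"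
    using assms by (intro sum_affine_cos_tau) auto
  finally show ?thesis .
qed

lemma invertible_mat_if_gram_diag:
  fixes A :: "'a :: field mat"
  assumes A: "A \<in> carrier_mat n n"
    and gram: "transpose_mat A * A = mat_diag n d"
    and d: "\<And>k. k < n \<Longrightarrow> d k \<noteq> 0"
  shows "invertible_mat A"
proof -
  let ?B = "mat_diag n (\<lambda>k. inverse (d k)) * transpose_mat A"
  have B: "?B \<in> carrier_mat n n" by (rule mult_carrier_mat[OF mat_diag_dim]) (simp add: A)
  have "?B * A = mat_diag n (\<lambda>k. inverse (d k)) * (transpose_mat A * A)"
    by (rule assoc_mult_mat[OF mat_diag_dim _ A]) (simp add: A)
  also have "\<dots> = mat_diag n (\<lambda>k. inverse (d k) * d k)"
    by (simp add: gram)
  also have "\<dots> = 1\<^sub>m n"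
    using d by (intro eq_matI) (auto simp: mat_diag_def)
  finally have BA: "?B * A = 1\<^sub>m n" .
  have AB: "A * ?B = 1\<^sub>m n" using mat_mult_left_right_inverse[OF B A BA] .
  have dim: "dim_row A = n" "dim_col A = n" "dim_row ?B = n" "dim_col ?B = n" using A B by auto
  have "inverts_mat A ?B" "inverts_mat ?B A"
    unfolding inverts_mat_def dim AB BA by auto
  then show ?thesis
    unfolding invertible_mat_def using A by auto
qed

theorem theorem6:
  fixes N :: nat and \<rho> :: real
  assumes "N \<ge> 2" and "0 < \<rho>" and "\<rho> < pi / (2 * real N)"
  shows "transpose_mat (Mhat N \<rho>) * Mhat N \<rho> =
           mat_diag N (\<lambda>k.
             if k = 0 then 2 * real N * (2 * \<rho>\<^sup>2 + (sin \<rho>)\<^sup>2)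
             else if k = 1 then 4 * real N * \<rho>\<^sup>2 * (sin \<rho>)\<^sup>2 / (2 * \<rho>\<^sup>2 + (sin \<rho>)\<^sup>2)
             else real N / 2 * (2 * sin (real k * \<rho>) / real k)\<^sup>2)
         \<and> invertible_mat (Mhat N \<rho>)"
proof -
  define d where "d = (\<lambda>k.
    if k = 0 then 2 * real N * (2 * \<rho>\<^sup>2 + (sin \<rho>)\<^sup>2)
    else if k = 1 then 4 * real N * \<rho>\<^sup>2 * (sin \<rho>)\<^sup>2 / (2 * \<rho>\<^sup>2 + (sin \<rho>)\<^sup>2)
    else real N / 2 * (2 * sin (real k * \<rho>) / real k)\<^sup>2)"
  have M: "Mhat N \<rho> \<in> carrier_mat N N" by (simp add: Mhat_def)
  define s where "s = sin \<rho>"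
  define D where "D = 2 * \<rho>\<^sup>2 + s\<^sup>2"
  have D: "D > 0" using assms unfolding D_def by (simp add: add_pos_nonneg)
  have l: "lambda1 \<rho> = s\<^sup>2 / D" and l': "1 - lambda1 \<rho> = 2 * \<rho>\<^sup>2 / D"
    using D unfolding lambda1_def s_def[symmetric] D_def[symmetric]
    by (simp_all add: D_def field_simps)
  have mean: "col_mean \<rho> 0 = 2 * \<rho>" "col_mean \<rho> 1 = - 2 * \<rho> * (s\<^sup>2 / D)"
    by (simp_all add: col_mean_def l)
  have amp: "col_amplitude \<rho> 0 = - 2 * s" "col_amplitude \<rho> 1 = - 2 * s * (2 * \<rho>\<^sup>2 / D)"
    by (simp_all add: col_amplitude_def l' s_def)
  let ?G = "\<lambda>j k. real N * col_mean \<rho> j * col_mean \<rho> k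
      + real N / 2 * col_amplitude \<rho> j * col_amplitude \<rho> k"
  have g00: "?G 0 0 = d 0"
    unfolding mean amp by (simp add: d_def s_def power2_eq_square algebra_simps)
  have g01: "?G 0 1 = 0"
    unfolding mean amp by (simp add: power2_eq_square)
  then have g10: "?G 1 0 = 0"
    by (simp add: mult.commute mult.left_commute)
  have g11: "?G 1 1 = d 1"
  proof -
    have "?G 1 1 = 4 * real N * \<rho>\<^sup>2 * s\<^sup>2 * D / (D * D)"
      unfolding mean amp D_def by (simp add: power2_eq_square algebra_simps add_divide_distrib)
    then show ?thesis using D by (simp add: d_def D_def s_def)
  qed
  have gkk: "real N / 2 * col_amplitude \<rho> k * col_amplitude \<rho> k = d k" if "2 \<le> k" for k
    using that by (simp add: d_def col_amplitude_def power2_eq_square)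
  have gram: "transpose_mat (Mhat N \<rho>) * Mhat N \<rho> = mat_diag N d"
  proof (rule eq_matI)
    fix j k assume "j < dim_row (mat_diag N d)" "k < dim_col (mat_diag N d)"
    then have jk: "j < N" "k < N" by (auto simp: mat_diag_def)
    have "(transpose_mat (Mhat N \<rho>) * Mhat N \<rho>) $$ (j, k) = (if j = k then d k else 0)"
    proof -
      have "j = 0 \<or> j = 1 \<or> 2 \<le> j" "k = 0 \<or> k = 1 \<or> 2 \<le> k" by linarith+
      then show ?thesis
        unfolding Mhat_gram_entry[OF assms(1) jk assms(2,3)]
        using g00 g01 g10 g11 gkk by (elim disjE) (auto simp: col_mean_def max_def)
    qed
    then show "(transpose_mat (Mhat N \<rho>) * Mhat N \<rho>) $$ (j, k) = mat_diag N d $$ (j, k)"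
      using jk by (simp add: mat_diag_def)
  qed (use M in \<open>auto simp: mat_diag_def\<close>)
  have "d k \<noteq> 0" if "k < N" for k
  proof -
    have sin_pos: "sin (real m * \<rho>) > 0" if "0 < m" "m < N" for m
    proof (rule sin_gt_zero)
      show "0 < real m * \<rho>" using that assms by simp
      have "real m * \<rho> \<le> real N * \<rho>" using that assms by (intro mult_right_mono) auto
      also have "\<dots> < 2 * real N * \<rho>" using assms by simp
      also have "\<dots> < pi" using assms by (simp add: field_simps)
      finally show "real m * \<rho> < pi" .
    qed
    have "s > 0" using sin_pos[of 1] assms by (simp add: s_def)
    then show ?thesis
      using that sin_pos[of k] D assms by (auto simp: d_def s_def[symmetric] D_def[symmetric])
  qed
  with M gram have "invertible_mat (Mhat N \<rho>)" by (rule invertible_mat_if_gram_diag)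
  with gram show ?thesis unfolding d_def by blast
qed

end
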